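(* Let $p^{a}_{1:K}=(p^a_1,\dots,p^a_K)\in[0,1]^K$ be the automation's posterior beliefs. Let $\mathcal{N}$ be the set returned by the Optimal Task Referral algorithm (described in the context) on input $p^{a}_{1:K}$, and for each $k\in\mathcal{K}\setminus\mathcal{N}$ let $D_k=\mathcal{H}_0$ if $\Gamma^{a}(p^{a}_k,\mathcal{H}_0)\le\Gamma^{a}(p^{a}_k,\mathcal{H}_1)$ and $D_k=\mathcal{H}_1$ otherwise. Then $(\mathcal{N},\{D_k\}_{k\in\mathcal{K}\setminus\mathcal{N}})$ is an optimal solution of the problem of minimizing $$J(\mathcal{N},\{D_k\}_{k\in\mathcal{K}\setminus\mathcal{N}},p^{a}_{1:K})=\sum_{k\in\mathcal{K}\setminus\mathcal{N}}\Gamma^{a}(p^{a}_k,D_k)+\sum_{n\in\mathcal{N}}\Gamma^{h}(p^{a}_n,|\mathcal{N}|)$$ over all subsets $\mathcal{N}\subseteq\mathcal{K}$ with $|\mathcal{N}|\in\mathcal{W}$ and all decisions $D_k\in\{\mathcal{H}_0,\mathcal{H}_1\}$, $k\in\mathcal{K}\setminus\mathcal{N}$.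
   Context: Setting: $K\ge 1$ is an integer, $\mathcal{K}=\{1,\dots,K\}$ indexes a batch of binary classification tasks, and $\{\mathcal{H}_0,\mathcal{H}_1\}$ is a two-element set of hypotheses. $\mathcal{W}\subseteq\{0,1,\dots,K\}$ is the nonempty set of possible task loads. An automation holds, for each task $k$, a posterior belief $p^a_k\in[0,1]$ (the conditional probability, given the automation's observation of task $k$, that the true state of task $k$ is $\mathcal{H}_1$). It refers a subset $\mathcal{N}\subseteq\mathcal{K}$ of the tasks, with $|\mathcal{N}|\in\mathcal{W}$, to a human operator and makes a terminal decision $D_k\in\{\mathcal{H}_0,\mathcal{H}_1\}$ for each task $k\in\mathcal{K}\setminus\mathcal{N}$. The task load is $|\mathcal{N}|$. Data: real decision costs $C(D,H)$ for $D,H\in\{\mathcal{H}_0,\mathcal{H}_1\}$, where $D$ is the decision and $H$ the true state, abbreviated $c_{tp}=C(\mathcal{H}_1,\mathcal{H}_1)$, $c_{fp}=C(\mathcal{H}_1,\mathcal{H}_0)$, $c_{tn}=C(\mathcal{H}_0,\mathcal{H}_0)$, $c_{fn}=C(\mathcal{H}_0,\mathcal{H}_1)$; a real referral cost $c_r$; and arbitrary functions $P^{h}_{tp},P^{h}_{fp}:\mathcal{W}\to[0,1]$ (the human operator's true positive and false positive rates as functions of task load). Definitions, for $p\in[0,1]$, $D\in\{\mathcal{H}_0,\mathcal{H}_1\}$ and $w\in\mathcal{W}$: $$\Gamma^{a}(p,D)=(1-p)\,C(D,\mathcal{H}_0)+p\,C(D,\mathcal{H}_1),$$ $$\Gamma^{a}_*(p)=\min\{\Gamma^{a}(p,\mathcal{H}_0),\Gamma^{a}(p,\mathcal{H}_1)\},$$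 $$\Gamma^{h}(p,w)=c_r+(1-p)\left[P^{h}_{fp}(w)c_{fp}+(1-P^{h}_{fp}(w))c_{tn}\right]+p\left[P^{h}_{tp}(w)c_{tp}+(1-P^{h}_{tp}(w))c_{fn}\right].$$ The referral index is $R(p,w)=\Gamma^{a}_*(p)-\Gamma^{h}(p,w)$. Optimal Task Referral algorithm. Input: $p^{a}_{1:K}$. Initialize $\mathcal{N}=\emptyset$ and $\delta^*=-\infty$. For each $w\in\mathcal{W}$ in turn: compute the referral indices $\{R(p^{a}_k,w)\}_{k\in\mathcal{K}}$; let $\mathcal{N}_w$ be a set of $w$ tasks with the top indices in $\{R(p^{a}_k,w)\}_{k\in\mathcal{K}}$ (ties broken arbitrarily); compute $\Delta(w)=\sum_{n\in\mathcal{N}_w}R(p^{a}_n,w)$; if $\Delta(w)>\delta^*$, set $\delta^*\gets\Delta(w)$ and $\mathcal{N}\gets\mathcal{N}_w$. Output: $\mathcal{N}$. *)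

theory Defs
  imports Complex_Main "HOL-Library.Extended_Real" "HOL-Library.FuncSet"
begin

datatype hyp = H0 | H1

text \<open>
  The cost function \<open>C D H\<close> takes the decision first and the true state second, so that
  \<open>C H1 H1\<close>, \<open>C H1 H0\<close>, \<open>C H0 H0\<close> and \<open>C H0 H1\<close> are the costs of a true positive, a false
  positive, a true negative and a false negative, respectively.
\<close>

definition gamma_a :: "(hyp \<Rightarrow> hyp \<Rightarrow> real) \<Rightarrow> real \<Rightarrow> hyp \<Rightarrow> real" where
  "gamma_a C p D = (1 - p) * C D H0 + p * C D H1"

definition gamma_a_star :: "(hyp \<Rightarrow> hyp \<Rightarrow> real) \<Rightarrow> real \<Rightarrow> real" where
  "gamma_a_star C p = min (gamma_a C p H0) (gamma_a C p H1)"

text \<open>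
  \<open>Ptp w\<close> and \<open>Pfp w\<close> are the true and false positive rates of the human operator at task load
  \<open>w\<close>, and \<open>cr\<close> is the referral cost.
\<close>

definition gamma_h ::
  "(hyp \<Rightarrow> hyp \<Rightarrow> real) \<Rightarrow> real \<Rightarrow> (nat \<Rightarrow> real) \<Rightarrow> (nat \<Rightarrow> real) \<Rightarrow> real \<Rightarrow> nat \<Rightarrow> real" where
  "gamma_h C cr Ptp Pfp p w =
     cr + (1 - p) * (Pfp w * C H1 H0 + (1 - Pfp w) * C H0 H0)
        + p * (Ptp w * C H1 H1 + (1 - Ptp w) * C H0 H1)"

definition referral_index ::
  "(hyp \<Rightarrow> hyp \<Rightarrow> real) \<Rightarrow> real \<Rightarrow> (nat \<Rightarrow> real) \<Rightarrow> (nat \<Rightarrow> real) \<Rightarrow> real \<Rightarrow> nat \<Rightarrow> real" where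
  "referral_index C cr Ptp Pfp p w = gamma_a_star C p - gamma_h C cr Ptp Pfp p w"

definition is_top_set :: "(nat \<Rightarrow> real) \<Rightarrow> nat set \<Rightarrow> nat \<Rightarrow> nat set \<Rightarrow> bool" where
  "is_top_set r T w N \<longleftrightarrow>
     N \<subseteq> T \<and> card N = w \<and> (\<forall>n\<in>N. \<forall>m\<in>T - N. r m \<le> r n)"

text \<open>
  \<open>otr_loop R T ws s s'\<close>: the loop of the Optimal Task Referral algorithm over the loads in the
  list \<open>ws\<close> can lead from state \<open>s\<close> to state \<open>s'\<close>. A state is a pair of the current best value
  and the current referral set; \<open>R k w\<close> is the referral index of task \<open>k\<close> at load \<open>w\<close>. It is a
  relation because ties in the choice of the top tasks are broken arbitrarily.
\<close>

inductive otr_loop ::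
  "(nat \<Rightarrow> nat \<Rightarrow> real) \<Rightarrow> nat set \<Rightarrow> nat list \<Rightarrow> ereal \<times> nat set \<Rightarrow> ereal \<times> nat set \<Rightarrow> bool"
  for R :: "nat \<Rightarrow> nat \<Rightarrow> real" and T :: "nat set" where
  finished: "otr_loop R T [] s s"
| iterate: "\<lbrakk> is_top_set (\<lambda>k. R k w) T w N\<^sub>w;
     \<Delta> = (\<Sum>n\<in>N\<^sub>w. R n w);
     otr_loop R T ws (if ereal \<Delta> > \<delta> then (ereal \<Delta>, N\<^sub>w) else (\<delta>, N)) s' \<rbrakk>
   \<Longrightarrow> otr_loop R T (w # ws) (\<delta>, N) s'"

text \<open>
  \<open>N\<close> is a possible output of the algorithm, for some order in which the loads in \<open>W\<close> are
  visited (each once) and some way of breaking ties.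
\<close>

definition otr_output ::
  "(hyp \<Rightarrow> hyp \<Rightarrow> real) \<Rightarrow> real \<Rightarrow> (nat \<Rightarrow> real) \<Rightarrow> (nat \<Rightarrow> real) \<Rightarrow> nat \<Rightarrow> nat set \<Rightarrow>
   (nat \<Rightarrow> real) \<Rightarrow> nat set \<Rightarrow> bool" where
  "otr_output C cr Ptp Pfp K W p N \<longleftrightarrow>
     (\<exists>ws \<delta>. distinct ws \<and> set ws = W \<and>
        otr_loop (\<lambda>k w. referral_index C cr Ptp Pfp (p k) w) {1..K} ws (-\<infinity>, {}) (\<delta>, N))"

text \<open>
  Decisions are functions on \<open>{1..K} - N\<close> only, represented extensionally.
\<close>

definition feasible :: "nat \<Rightarrow> nat set \<Rightarrow> nat set \<times> (nat \<Rightarrow> hyp) \<Rightarrow> bool" where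
  "feasible K W = (\<lambda>(N, D). N \<subseteq> {1..K} \<and> card N \<in> W \<and> D \<in> ({1..K} - N) \<rightarrow>\<^sub>E UNIV)"

definition total_cost ::
  "(hyp \<Rightarrow> hyp \<Rightarrow> real) \<Rightarrow> real \<Rightarrow> (nat \<Rightarrow> real) \<Rightarrow> (nat \<Rightarrow> real) \<Rightarrow> nat \<Rightarrow> (nat \<Rightarrow> real) \<Rightarrow>
   nat set \<times> (nat \<Rightarrow> hyp) \<Rightarrow> real" where
  "total_cost C cr Ptp Pfp K p = (\<lambda>(N, D).
     (\<Sum>k\<in>{1..K} - N. gamma_a C (p k) (D k)) +
     (\<Sum>n\<in>N. gamma_h C cr Ptp Pfp (p n) (card N)))"

definition auto_decision :: "(hyp \<Rightarrow> hyp \<Rightarrow> real) \<Rightarrow> real \<Rightarrow> hyp" where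
  "auto_decision C p = (if gamma_a C p H0 \<le> gamma_a C p H1 then H0 else H1)"

text \<open>The algorithm always has an output, so quantifying over its outputs is not vacuous.\<close>

lemma is_top_set_exists:
  assumes "finite T" "w \<le> card T"
  shows "\<exists>N. is_top_set r T w N"
  using assms(2)
proof (induction w)
  case 0
  show ?case by (rule exI[of _ "{}"]) (simp add: is_top_set_def)
next
  case (Suc w)
  then obtain N where N: "N \<subseteq> T" "card N = w" "\<And>n m. n \<in> N \<Longrightarrow> m \<in> T - N \<Longrightarrow> r m \<le> r n"
    by (auto simp: is_top_set_def)
  have fin: "finite N" using N(1) assms(1) finite_subset by blast
  have "T - N \<noteq> {}" using N Suc.prems fin card_mono[of N T] by auto
  then have "Max (r ` (T - N)) \<in> r ` (T - N)" using assms(1) by (intro Max_in) auto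
  then obtain x where x: "x \<in> T - N" "r x = Max (r ` (T - N))" by auto
  have max: "r m \<le> r x" if "m \<in> T - N" for m
    using that assms(1) by (auto simp: x(2))
  have "is_top_set r T (Suc w) (insert x N)"
    unfolding is_top_set_def using N x(1) max fin by auto
  then show ?case by blast
qed

lemma otr_loop_exists:
  assumes "finite T" "\<And>w. w \<in> set ws \<Longrightarrow> w \<le> card T"
  shows "\<exists>s'. otr_loop R T ws s s'"
  using assms(2)
proof (induction ws arbitrary: s)
  case Nil
  show ?case using otr_loop.finished by blast
next
  case (Cons w ws)
  obtain \<delta> N where s: "s = (\<delta>, N)" by (cases s)
  obtain M where "is_top_set (\<lambda>k. R k w) T w M"
    using is_top_set_exists[OF assms(1)] Cons.prems by (meson list.set_intros(1))
  moreover obtain s' where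
    "otr_loop R T ws (if ereal (\<Sum>n\<in>M. R n w) > \<delta> then (ereal (\<Sum>n\<in>M. R n w), M) else (\<delta>, N)) s'"
    using Cons.IH Cons.prems by (meson list.set_intros(2))
  ultimately show ?case unfolding s using otr_loop.iterate by blast
qed

lemma otr_output_exists:
  assumes "W \<subseteq> {0..K}"
  shows "\<exists>N. otr_output C cr Ptp Pfp K W p N"
proof -
  have "finite W" using assms finite_subset by blast
  then obtain ws where "distinct ws" "set ws = W" using finite_distinct_list by blast
  moreover have "\<exists>s'. otr_loop (\<lambda>k w. referral_index C cr Ptp Pfp (p k) w) {1..K} ws (-\<infinity>, {}) s'"
    using assms calculation by (intro otr_loop_exists) auto
  ultimately show ?thesis unfolding otr_output_def by (metis surj_pair)
qed

end

theory Submission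
  imports Defs
begin

text \<open>
  Deciding every retained task by the cheaper decision turns the cost of a referral set \<open>N\<close> into
  the constant \<open>\<Sum>k. gamma_a_star C (p k)\<close> minus the total referral index of \<open>N\<close> at load
  \<open>card N\<close>. For a fixed load, this total is largest on a set of top indices, and the loop takes the
  maximum over the loads.
\<close>

text \<open>An exchange argument: \<open>N - M\<close> and \<open>M - N\<close> have equal size, so
  a bijection replaces each element of \<open>N - M\<close> by one of \<open>M - N\<close>, whose
  value is no larger because \<open>N\<close> is a top set. The common part
  \<open>N \<inter> M\<close> contributes equally to both sums.\<close>

lemma is_top_set_sum_max:
  assumes "finite T" "is_top_set r T w N" "M \<subseteq> T" "card M = w"
  shows "sum r M \<le> sum r N"
proof -
  have N: "N \<subseteq> T" "card N = w" "\<And>n m. n \<in> N \<Longrightarrow> m \<in> T - N \<Longrightarrow> r m \<le> r n"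
    using assms(2) by (auto simp: is_top_set_def)
  have fin: "finite N" "finite M"
    using N(1) assms(1,3) finite_subset by blast+
  have "card (N - M) = card (M - N)"
    using fin N(2) assms(4) by (simp add: card_Diff_subset_Int Int_commute)
  then obtain f where f: "bij_betw f (N - M) (M - N)"
    using fin by (meson finite_Diff finite_same_card_bij)
  have "sum r (M - N) = (\<Sum>n\<in>N - M. r (f n))"
    by (rule sum.reindex_bij_betw[OF f, symmetric])
  also have "\<dots> \<le> sum r (N - M)"
  proof (rule sum_mono)
    fix n assume n: "n \<in> N - M"
    then have "f n \<in> M - N"
      using bij_betwE[OF f] by blast
    then show "r (f n) \<le> r n"
      using n N(3) assms(3) by blast
  qed
  finally show ?thesis
    using sum.Int_Diff[OF fin(1), of r M] sum.Int_Diff[OF fin(2), of r N]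
    by (simp add: Int_commute)
qed

lemma otr_loop_mono:
  assumes "otr_loop R T ws s s'"
  shows "fst s \<le> fst s'"
  using assms by induction (auto split: if_splits)

text \<open>The iteration for load \<open>card M\<close> raises the stored value to at least the top
  sum for that load, which dominates the sum over \<open>M\<close>; the other iterations never lower
  the stored value.\<close>

lemma otr_loop_ge:
  assumes "otr_loop R T ws s s'" "finite T" "M \<subseteq> T" "card M \<in> set ws"
  shows "ereal (\<Sum>n\<in>M. R n (card M)) \<le> fst s'"
  using assms(1,4)
proof induction
  case (iterate w N\<^sub>w \<Delta> ws \<delta> N s')
  show ?case
  proof (cases "card M = w")
    case True
    then have "(\<Sum>n\<in>M. R n (card M)) \<le> \<Delta>"
      using is_top_set_sum_max[OF assms(2) iterate.hyps(1) assms(3)] iterate.hyps(2) by simp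
    \<comment> \<open>The remaining loop starts from the updated state, whose value is the maximum
      of \<open>\<Delta>\<close> and \<open>\<delta>\<close>.\<close>
    also have "ereal \<Delta> \<le> fst s'"
      using otr_loop_mono[OF iterate.hyps(3)] by (auto split: if_splits)
    finally show ?thesis by simp
  next
    case False
    then show ?thesis using iterate by simp
  qed
qed simp

text \<open>Value and set are always overwritten together, so they stay consistent after the first
  update. The disjunct \<open>s' = s\<close> covers a run without any update.\<close>

lemma otr_loop_result:
  assumes "otr_loop R T ws s s'"
  shows "s' = s \<or> (snd s' \<subseteq> T \<and> card (snd s') \<in> set ws \<and>
    fst s' = ereal (\<Sum>n\<in>snd s'. R n (card (snd s'))))"
  using assms by induction (auto simp: is_top_set_def split: if_splits)

lemma otr_output_optimal:
  assumes "W \<noteq> {}" "W \<subseteq> {0..K}" "otr_output C cr Ptp Pfp K W p N"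
  defines "R \<equiv> \<lambda>k w. referral_index C cr Ptp Pfp (p k) w"
  shows "N \<subseteq> {1..K}" "card N \<in> W"
    and "\<And>M. M \<subseteq> {1..K} \<Longrightarrow> card M \<in> W \<Longrightarrow>
      (\<Sum>n\<in>M. R n (card M)) \<le> (\<Sum>n\<in>N. R n (card N))"
proof -
  obtain ws \<delta> where ws: "set ws = W" and loop: "otr_loop R {1..K} ws (-\<infinity>, {}) (\<delta>, N)"
    using assms(3) unfolding otr_output_def R_def by blast
  have ge: "ereal (\<Sum>n\<in>M. R n (card M)) \<le> \<delta>" if "M \<subseteq> {1..K}" "card M \<in> W" for M
    using otr_loop_ge[OF loop _ that(1)] that(2) ws by simp
  \<comment> \<open>Some admissible referral set exists, and its real total bounds
    \<open>\<delta>\<close> from below. Hence \<open>\<delta>\<close> is not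
    \<open>-\<infinity>\<close>, which rules out that the loop ended in its initial state.\<close>
  obtain w where w: "w \<in> W" "w \<le> card {1..K}"
    using assms(1,2) by fastforce
  then obtain M where "M \<subseteq> {1..K}" "card M = w"
    using obtain_subset_with_card_n by metis
  then have "\<delta> \<noteq> -\<infinity>"
    using ge[of M] w by auto
  then have "N \<subseteq> {1..K} \<and> card N \<in> W \<and> \<delta> = ereal (\<Sum>n\<in>N. R n (card N))"
    using otr_loop_result[OF loop] ws by auto
  then show "N \<subseteq> {1..K}" "card N \<in> W"
    and "\<And>M. M \<subseteq> {1..K} \<Longrightarrow> card M \<in> W \<Longrightarrow>
      (\<Sum>n\<in>M. R n (card M)) \<le> (\<Sum>n\<in>N. R n (card N))"
    using ge by auto
qed

lemma gamma_a_star_le: "gamma_a_star C q \<le> gamma_a C q D"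
  by (cases D) (auto simp: gamma_a_star_def)

lemma gamma_a_auto_decision: "gamma_a C q (auto_decision C q) = gamma_a_star C q"
  by (auto simp: gamma_a_star_def auto_decision_def)

text \<open>Adding and subtracting \<open>gamma_a_star\<close> over \<open>N\<close> completes the
  first sum to all tasks, which no longer depends on \<open>N\<close>.\<close>

lemma sum_gamma_a_star_split:
  fixes K :: nat
  assumes "N \<subseteq> {1..K}"
  shows "(\<Sum>k\<in>{1..K} - N. gamma_a_star C (p k)) + (\<Sum>n\<in>N. gamma_h C cr Ptp Pfp (p n) w)
    = (\<Sum>k\<in>{1..K}. gamma_a_star C (p k)) - (\<Sum>n\<in>N. referral_index C cr Ptp Pfp (p n) w)"
  using sum.subset_diff[OF assms finite_atLeastAtMost, of "\<lambda>k. gamma_a_star C (p k)"]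
  by (simp add: referral_index_def sum_subtractf)

theorem theorem2:
  fixes C :: "hyp \<Rightarrow> hyp \<Rightarrow> real" and cr :: real
    and Ptp Pfp :: "nat \<Rightarrow> real" and p :: "nat \<Rightarrow> real"
    and K :: nat and W N :: "nat set"
  assumes "K \<ge> 1"
    and "W \<noteq> {}" and "W \<subseteq> {0..K}"
    and "\<And>w. w \<in> W \<Longrightarrow> Ptp w \<in> {0..1}"
    and "\<And>w. w \<in> W \<Longrightarrow> Pfp w \<in> {0..1}"
    and "\<And>k. k \<in> {1..K} \<Longrightarrow> p k \<in> {0..1}"
    and "otr_output C cr Ptp Pfp K W p N"
  shows "is_arg_min (total_cost C cr Ptp Pfp K p) (feasible K W)
           (N, \<lambda>k\<in>{1..K} - N. auto_decision C (p k))"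
proof -
  note opt = otr_output_optimal[OF assms(2,3,7)]
  let ?cost = "total_cost C cr Ptp Pfp K p"
  let ?best = "(N, \<lambda>k\<in>{1..K} - N. auto_decision C (p k))"
  have "?cost ?best \<le> ?cost (M, D)" if "feasible K W (M, D)" for M D
  proof -
    have M: "M \<subseteq> {1..K}" "card M \<in> W"
      using that by (auto simp: feasible_def)
    have "?cost ?best = (\<Sum>k\<in>{1..K}. gamma_a_star C (p k))
        - (\<Sum>n\<in>N. referral_index C cr Ptp Pfp (p n) (card N))"
      unfolding sum_gamma_a_star_split[OF opt(1), symmetric]
      by (simp add: total_cost_def gamma_a_auto_decision)
    also have "\<dots> \<le> (\<Sum>k\<in>{1..K}. gamma_a_star C (p k))
        - (\<Sum>n\<in>M. referral_index C cr Ptp Pfp (p n) (card M))"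
      using opt(3)[OF M] by simp
    also have "\<dots> = (\<Sum>k\<in>{1..K} - M. gamma_a_star C (p k))
        + (\<Sum>n\<in>M. gamma_h C cr Ptp Pfp (p n) (card M))"
      by (rule sum_gamma_a_star_split[OF M(1), symmetric])
    \<comment> \<open>The referral terms agree, and on each retained task
      \<open>gamma_a_star\<close> is a lower bound for the cost of any decision.\<close>
    also have "\<dots> \<le> ?cost (M, D)"
      by (simp add: total_cost_def sum_mono gamma_a_star_le)
    finally show ?thesis .
  qed
  moreover have "feasible K W ?best"
    using opt(1,2) by (simp add: feasible_def)
  ultimately show ?thesis
    unfolding is_arg_min_linorder by auto
qed

end
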